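(* Let $R$ be a ring with involution, let $a\in R$ be Drazin invertible, and let $a^{+},a^{\pm}\in T_l(a)$ be two minimal weak Drazin inverses of $a$. Let $b\in R$, $f=a+b$ and let $s$ be a positive integer. If $1+a^{+}b$ is invertible, then the following are equivalent: (1) $(1-aa^{+})baa^{+}=0$ and $(1-aa^{+})(a+b)^s(1-aa^{+})=0$; (2) $(1+a^{+}b)^{-1}a^{+}$ is a minimal weak Drazin inverse of $f$, and ${\rm i}(f)\leqslant s$; (3) $(1+a^{+}b)^{-1}a^{\pm}$ is a minimal weak Drazin inverse of $f$, and ${\rm i}(f)\leqslant s$. In this case, $T_l(f)=\alpha T_l(a)=\{(1+a^{+}b)^{-1}y:\ y\in T_l(a)\}$, where $\alpha=(1+a^{+}b)^{-1}$.
   Context: Rings are associative with identity $1$. An element $a\in R$ is Drazin invertible if there are $x\in R$ and a positive integer $k$ with $xa^{k+1}=a^k$, $ax^2=x$, $xa=ax$; then $x$ is unique and denoted $a^D$, and the smallest positive integer $k$ for which these equations hold is the Drazin index ${\rm i}(a)$. For a Drazin invertible $a$, $T_l(a)=\{x\in R:\ xa^{k+1}=a^k \text{ for some positive integer } k,\ ax^2=x\}$; its elements are called the minimal weak Drazin inverses of $a$. If some $x\in R$ and positive integer $k$ satisfy $xa^{k+1}=a^k$ and $ax^2=x$, then $a$ is automatically Drazin invertible, so that "$f$ has a minimal weak Drazin inverse" implies that $f$ is Drazin invertible and ${\rm i}(f)$ is defined. *)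

theory Defs
  imports Main
begin

text \<open>
  Rings are modelled by the sort \<open>{ring, monoid_mult}\<close>, that is, associative rings with identity.
  The class \<open>ring_1\<close> additionally demands \<open>0 \<noteq> 1\<close> and would exclude the zero ring.
\<close>

definition involution :: "('a::{ring,monoid_mult} \<Rightarrow> 'a) \<Rightarrow> bool" where
  "involution star \<longleftrightarrow>
     (\<forall>x. star (star x) = x) \<and>
     (\<forall>x y. star (x + y) = star x + star y) \<and>
     (\<forall>x y. star (x * y) = star y * star x)"

definition is_invertible :: "'a::monoid_mult \<Rightarrow> bool" where
  "is_invertible u \<longleftrightarrow> (\<exists>v. u * v = 1 \<and> v * u = 1)"

text \<open>Only meaningful for invertible arguments, where the two-sided inverse is unique.\<close>

definition ring_inv :: "'a::monoid_mult \<Rightarrow> 'a" where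
  "ring_inv u = (THE v. u * v = 1 \<and> v * u = 1)"

lemma ring_inv_unique:
  assumes "u * v = 1" and "v * u = 1"
  shows "ring_inv u = v"
  unfolding ring_inv_def
proof (rule the_equality)
  show "u * v = 1 \<and> v * u = 1" using assms by simp
next
  fix w assume "u * w = 1 \<and> w * u = 1"
  then show "w = v" using assms by (metis mult.assoc mult_1_left mult_1_right)
qed

definition drazin_eqs :: "'a::{ring,monoid_mult} \<Rightarrow> 'a \<Rightarrow> nat \<Rightarrow> bool" where
  "drazin_eqs a x k \<longleftrightarrow> x * a ^ (k + 1) = a ^ k \<and> a * x\<^sup>2 = x \<and> x * a = a * x"

definition drazin_invertible :: "'a::{ring,monoid_mult} \<Rightarrow> bool" where
  "drazin_invertible a \<longleftrightarrow> (\<exists>x k. 0 < k \<and> drazin_eqs a x k)"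

text \<open>
  The Drazin inverse \<open>x\<close> is unique and does not depend on \<open>k\<close>, so it can be quantified
  inside \<open>LEAST\<close>. The value is only meaningful if \<open>a\<close> is Drazin invertible.
\<close>

definition drazin_index :: "'a::{ring,monoid_mult} \<Rightarrow> nat" where
  "drazin_index a = (LEAST k. 0 < k \<and> (\<exists>x. drazin_eqs a x k))"

text \<open>
  The set \<open>T\<^sub>l(a)\<close> of minimal weak Drazin inverses. If it is nonempty, \<open>a\<close> is Drazin
  invertible, so \<open>drazin_index a\<close> is then meaningful.
\<close>

definition T_l :: "'a::{ring,monoid_mult} \<Rightarrow> 'a set" where
  "T_l a = {x. (\<exists>k>0. x * a ^ (k + 1) = a ^ k) \<and> a * x\<^sup>2 = x}"

end

theory Submission
  imports Defs
begin

text \<open>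
  A minimal weak Drazin inverse \<open>x\<close> of \<open>a\<close> has a geometric meaning.  The idempotent
  \<open>p = a * x\<close> projects onto the right ideal \<open>p R = x R = a^k R\<close> for all large \<open>k\<close>, the
  eventual image of \<open>a\<close>.  Left multiplication by \<open>a\<close> permutes this ideal, and left
  multiplication by \<open>x\<close> inverts it there.  Off the ideal \<open>x\<close> is constrained only by
  \<open>x \<in> p R\<close>, which is why there are many such \<open>x\<close>.  This is the content of
  \<open>inverse_on p a x\<close> together with \<open>p * a ^ k = a ^ k\<close>
  (\<open>weak_drazin_eqs_imp_inverse_on\<close>, \<open>inverse_on_imp_weak_drazin_eqs\<close>).  The exponents \<open>k\<close>
  that occur are governed by the Drazin index alone (\<open>T_l_index_le_iff\<close>).

  Write \<open>f = a + b\<close>, \<open>u = 1 + x * b\<close> and \<open>\<alpha>\<close> for the inverse of \<open>u\<close>.  Because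
  \<open>x\<close> has image in \<open>p R\<close>, both \<open>u\<close> and \<open>\<alpha>\<close> map \<open>p R\<close> into itself.  The
  first part of condition (1) says that \<open>b\<close>, hence \<open>f\<close>, leaves \<open>p R\<close> invariant, and in that
  case \<open>f = a * u\<close> on \<open>p R\<close>.  Inverting this product shows that \<open>y\<close> inverts \<open>a\<close> on \<open>p R\<close>
  exactly when \<open>\<alpha> * y\<close> inverts \<open>f\<close> there (\<open>inverse_on_mult\<close>).  The second part of (1) then
  says that \<open>f ^ s\<close> has image in \<open>p R\<close>, so that \<open>p R\<close> is the eventual image of \<open>f\<close>, reached
  after at most \<open>s\<close> steps.  Conversely, if \<open>\<alpha> * y\<close> is a minimal weak Drazin inverse of
  \<open>f\<close> and the index of \<open>f\<close> is at most \<open>s\<close>, then \<open>f ^ s R\<close> is already the eventual image of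
  \<open>f\<close>, which is \<open>\<alpha> * y R = \<alpha> * p R = p R\<close>, and both parts of (1)
  can be read off.  As \<open>y \<in> T_l a\<close> is arbitrary here (\<open>perturbed_T_l_iff\<close>), the equivalence of
  (1) with (2) and with (3) is the same fact for two choices of \<open>y\<close>.  Under (1), every
  \<open>w \<in> T_l f\<close> inverts \<open>f\<close> on \<open>p R\<close>, so \<open>u * w\<close> inverts \<open>a\<close> there; this gives the
  description of \<open>T_l f\<close> (\<open>perturbed_T_l_eq\<close>).
\<close>

section \<open>Minimal weak Drazin inverses as inverses on a right ideal\<close>

definition weak_drazin_eqs :: "'a::monoid_mult \<Rightarrow> 'a \<Rightarrow> nat \<Rightarrow> bool" where
  "weak_drazin_eqs a x k \<longleftrightarrow> x * a ^ (k + 1) = a ^ k \<and> a * x\<^sup>2 = x"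

lemma T_l_iff: "x \<in> T_l a \<longleftrightarrow> (\<exists>k>0. weak_drazin_eqs a x k)"
  unfolding T_l_def weak_drazin_eqs_def by auto

text \<open>
  For an idempotent \<open>p\<close> this says that left multiplication by \<open>f\<close> maps the right ideal \<open>p R\<close>
  bijectively to itself, that \<open>w\<close> is its inverse there, and that \<open>w\<close> has its whole image in
  \<open>p R\<close>.  Invariance of \<open>p R\<close> under \<open>f\<close> is a separate clause: the other three do not imply it.
\<close>

definition inverse_on :: "'a::monoid_mult \<Rightarrow> 'a \<Rightarrow> 'a \<Rightarrow> bool" where
  "inverse_on p f w \<longleftrightarrow> p * w = w \<and> p * f * p = f * p \<and> f * w * p = p \<and> w * f * p = p"

lemma weak_drazin_eqs_mono:
  assumes "weak_drazin_eqs a x k" and "k \<le> m"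
  shows "weak_drazin_eqs a x m"
proof -
  from assms(2) obtain j where m: "m = k + j" using le_Suc_ex by blast
  have "x * a ^ (m + 1) = (x * a ^ (k + 1)) * a ^ j"
    by (simp add: m power_add mult.assoc)
  also have "\<dots> = a ^ m"
    using assms(1) by (simp add: weak_drazin_eqs_def m power_add)
  finally show ?thesis using assms(1) by (simp add: weak_drazin_eqs_def)
qed

text \<open>Iterating \<open>a * x\<^sup>2 = x\<close> exhibits \<open>x\<close> as an element of \<open>a ^ j R\<close> for every \<open>j\<close>.\<close>

lemma power_mult_power_Suc:
  fixes a x :: "'a::monoid_mult"
  assumes "a * x\<^sup>2 = x"
  shows "a ^ j * x ^ Suc j = x"
proof (induction j)
  case (Suc j)
  have "a ^ Suc j * x ^ Suc (Suc j) = a ^ j * (a * x\<^sup>2) * x ^ j"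
    by (simp add: power2_eq_square mult.assoc power_commutes)
      (metis mult.assoc power_commutes)
  then show ?case using Suc assms by (simp add: mult.assoc)
qed simp

text \<open>
  All solutions of the equations for \<open>a\<close> share their image: \<open>y\<close> lies in \<open>a ^ k R\<close>, where
  \<open>x * a\<close> acts as the identity.
\<close>

lemma weak_drazin_eqs_cancel:
  assumes x: "weak_drazin_eqs a x k" and y: "a * y\<^sup>2 = y"
  shows "x * a * y = y"
proof -
  have "x * a * y = x * a * (a ^ k * y ^ Suc k)"
    using power_mult_power_Suc[OF y] by simp
  also have "\<dots> = (x * a ^ (k + 1)) * y ^ Suc k" by (simp add: mult.assoc)
  also have "\<dots> = a ^ k * y ^ Suc k" using x by (simp add: weak_drazin_eqs_def)
  finally show ?thesis using power_mult_power_Suc[OF y] by simp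
qed

lemma weak_drazin_eqs_absorb:
  assumes x: "weak_drazin_eqs a x k" and y: "a * y\<^sup>2 = y"
  shows "a * x * y = y"
proof -
  have "a * x * y = a * x * (x * a * y)"
    using weak_drazin_eqs_cancel[OF x y] by simp
  also have "\<dots> = a * x\<^sup>2 * (a * y)" by (simp add: mult.assoc power2_eq_square)
  also have "\<dots> = x * a * y" using x by (simp add: weak_drazin_eqs_def mult.assoc)
  finally show ?thesis using weak_drazin_eqs_cancel[OF x y] by simp
qed

text \<open>\<open>a * x\<close> lies in the right ideal generated by \<open>x\<close>, so that ideal is invariant under \<open>a\<close>.\<close>

lemma weak_drazin_eqs_mult_in_image:
  assumes x: "weak_drazin_eqs a x k"
  shows "x * (a * (a * x)) = a * x"
proof -
  have ax: "a * x = a ^ (k + 1) * x ^ (k + 1)"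
    using power_mult_power_Suc[of a x k] x by (simp add: weak_drazin_eqs_def mult.assoc)
  have "x * (a * (a * x)) = x * a ^ (k + 2) * x ^ (k + 1)"
    unfolding ax by (simp add: mult.assoc)
  also have "x * a ^ (k + 2) = a ^ (k + 1)"
    using weak_drazin_eqs_mono[OF x, of "k + 1"] by (simp add: weak_drazin_eqs_def)
  finally show ?thesis using ax by simp
qed

lemma weak_drazin_eqs_imp_idempotent:
  assumes "weak_drazin_eqs a x k"
  shows "(a * x) * (a * x) = a * x"
  using weak_drazin_eqs_cancel[OF assms, of x] assms
  by (simp add: weak_drazin_eqs_def mult.assoc)

lemma weak_drazin_eqs_imp_absorb_power:
  assumes "weak_drazin_eqs a x k"
  shows "(a * x) * a ^ k = a ^ k"
proof -
  have x: "x * a ^ (k + 1) = a ^ k" and ax: "a * x\<^sup>2 = x"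
    using assms by (simp_all add: weak_drazin_eqs_def)
  have "(a * x) * a ^ k = (a * x) * (x * a ^ (k + 1))" using x by simp
  also have "\<dots> = a * x\<^sup>2 * a ^ (k + 1)" by (simp add: power2_eq_square mult.assoc)
  finally show ?thesis using x ax by simp
qed

text \<open>The image does not depend on the solution, so \<open>y\<close> inverts \<open>a\<close> on the image of \<open>a * x\<close> too.\<close>

lemma weak_drazin_eqs_imp_inverse_on:
  assumes x: "weak_drazin_eqs a x k" and y: "weak_drazin_eqs a y l"
  shows "inverse_on (a * x) a y"
proof -
  have ax: "a * x\<^sup>2 = x" and ay: "a * y\<^sup>2 = y"
    using x y by (simp_all add: weak_drazin_eqs_def)
  have ax_gen: "a * x = x * (a * (a * x))" using weak_drazin_eqs_mult_in_image[OF x] by simp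
  have "a * x * a * (a * x) = a * (a * x)"
    using ax_gen by (simp add: mult.assoc)
  moreover have "a * y * (a * x) = a * x"
  proof -
    have "a * y * (a * x) = (a * y * x) * (a * (a * x))"
      by (subst ax_gen) (simp add: mult.assoc)
    then show ?thesis using weak_drazin_eqs_absorb[OF y ax] ax_gen by simp
  qed
  moreover have "y * a * (a * x) = a * x"
  proof -
    have "y * a * (a * x) = (y * a * x) * (a * (a * x))"
      by (subst ax_gen) (simp add: mult.assoc)
    then show ?thesis using weak_drazin_eqs_cancel[OF y ax] ax_gen by simp
  qed
  ultimately show ?thesis
    using weak_drazin_eqs_absorb[OF x ay] by (simp add: inverse_on_def)
qed

lemma inverse_on_imp_weak_drazin_eqs:
  assumes w: "inverse_on p f w" and p: "p * f ^ k = f ^ k"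
  shows "weak_drazin_eqs f w k"
proof -
  have "w * f ^ (k + 1) = w * f * p * f ^ k"
    using p by (simp add: mult.assoc)
  also have "\<dots> = f ^ k" using w p by (simp add: inverse_on_def)
  finally have 1: "w * f ^ (k + 1) = f ^ k" .
  have "f * w\<^sup>2 = f * w * (p * w)"
    using w by (simp add: inverse_on_def power2_eq_square mult.assoc)
  also have "\<dots> = f * w * p * w" by (simp add: mult.assoc)
  also have "\<dots> = w" using w by (simp add: inverse_on_def)
  finally show ?thesis using 1 by (simp add: weak_drazin_eqs_def)
qed

text \<open>The relation depends on \<open>p\<close> only through its right ideal: here \<open>p R = q R\<close>.\<close>

lemma inverse_on_change_projection:
  assumes w: "inverse_on p f w" and pq: "p * q = q" and qp: "q * p = p"
  shows "inverse_on q f w"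
proof -
  have "q * w = q * p * w" using w by (simp add: inverse_on_def mult.assoc)
  then have 1: "q * w = w" using qp w by (simp add: inverse_on_def)
  have "q * f * q = q * (f * p) * q" using pq by (simp add: mult.assoc)
  also have "\<dots> = q * (p * f * p) * q" using w by (simp add: inverse_on_def)
  also have "\<dots> = (q * p) * f * (p * q)" by (simp add: mult.assoc)
  also have "\<dots> = (p * f * p) * q" using pq qp by (simp add: mult.assoc)
  also have "\<dots> = f * q" using w pq by (simp add: inverse_on_def mult.assoc)
  finally have 2: "q * f * q = f * q" .
  have "f * w * q = (f * w * p) * q" using pq by (simp add: mult.assoc)
  then have 3: "f * w * q = q" using w pq by (simp add: inverse_on_def)
  have "w * f * q = (w * f * p) * q" using pq by (simp add: mult.assoc)
  then have 4: "w * f * q = q" using w pq by (simp add: inverse_on_def)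
  from 1 2 3 4 show ?thesis by (simp add: inverse_on_def)
qed

section \<open>Exponents and the Drazin index\<close>

text \<open>
  A weak inverse can be made to commute with \<open>a\<close> without changing its exponent: \<open>x\<close> already
  inverts \<open>a\<close> on the image of \<open>a ^ k\<close>, so \<open>x ^ (k + 1) * a ^ k\<close> is the Drazin inverse.
\<close>

lemma weak_drazin_eqs_imp_drazin_eqs:
  assumes x: "weak_drazin_eqs a x k" and k: "0 < k"
  shows "drazin_eqs a (x ^ (k + 1) * a ^ k) k"
proof -
  have ax: "a * x\<^sup>2 = x" using x by (simp add: weak_drazin_eqs_def)
  have cancel: "x ^ j * a ^ (k + j) = a ^ k" for j
  proof (induction j)
    case (Suc j)
    have "x ^ Suc j * a ^ (k + Suc j) = x ^ j * (x * a ^ ((k + j) + 1))"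
      by (simp add: power_Suc2 mult.assoc del: power_Suc)
    also have "x * a ^ ((k + j) + 1) = a ^ (k + j)"
      using weak_drazin_eqs_mono[OF x, of "k + j"] by (simp add: weak_drazin_eqs_def)
    finally show ?case using Suc by simp
  qed simp
  have "x ^ (k + 1) * a ^ k * a ^ (k + 1) = x ^ (k + 1) * a ^ (k + (k + 1))"
    by (simp only: power_add mult.assoc)
  then have 1: "x ^ (k + 1) * a ^ k * a ^ (k + 1) = a ^ k" using cancel[of "k + 1"] by simp
  obtain m where m: "k = Suc m" using k gr0_implies_Suc by blast
  have "a * x ^ (k + 1) = a * x\<^sup>2 * x ^ m"
    by (simp add: m power2_eq_square mult.assoc)
  then have left: "a * x ^ (k + 1) = x ^ k" using ax by (simp add: m)
  have "x ^ (k + 1) * a ^ k * a = x ^ k * (x * a ^ (k + 1))"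
    by (simp add: power_commutes mult.assoc) (metis mult.assoc power_commutes)
  then have right: "x ^ (k + 1) * a ^ k * a = x ^ k * a ^ k"
    using x by (simp add: weak_drazin_eqs_def)
  have 2: "x ^ (k + 1) * a ^ k * a = a * (x ^ (k + 1) * a ^ k)"
    using left right by (metis mult.assoc)
  have "a * (x ^ (k + 1) * a ^ k)\<^sup>2 = (a * x ^ (k + 1)) * (a ^ k * x ^ Suc k) * a ^ k"
    by (simp add: power2_eq_square mult.assoc)
  also have "\<dots> = x ^ k * x * a ^ k"
    using left power_mult_power_Suc[OF ax, of k] by simp
  also have "\<dots> = x ^ (k + 1) * a ^ k" by (simp add: power_commutes)
  finally show ?thesis using 1 2 by (simp add: drazin_eqs_def)
qed

text \<open>
  The Drazin index is the least exponent that works for any one minimal weak Drazin inverse,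
  hence for all of them: \<open>f ^ s\<close> lies in the image of the Drazin inverse, where \<open>w * f\<close> acts as
  the identity for every \<open>w \<in> T_l f\<close>.
\<close>

lemma T_l_index_le_iff:
  assumes s: "0 < s"
  shows "w \<in> T_l f \<and> drazin_index f \<le> s \<longleftrightarrow> weak_drazin_eqs f w s"
proof
  assume w: "weak_drazin_eqs f w s"
  have "drazin_index f \<le> s"
    unfolding drazin_index_def
    by (rule Least_le) (use weak_drazin_eqs_imp_drazin_eqs[OF w s] s in blast)
  then show "w \<in> T_l f \<and> drazin_index f \<le> s" using w s T_l_iff by blast
next
  assume asm: "w \<in> T_l f \<and> drazin_index f \<le> s"
  then obtain k where k: "0 < k" and w: "weak_drazin_eqs f w k" using T_l_iff by blast
  have "\<exists>k. 0 < k \<and> (\<exists>d. drazin_eqs f d k)"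
    using weak_drazin_eqs_imp_drazin_eqs[OF w k] k by blast
  then have "0 < drazin_index f \<and> (\<exists>d. drazin_eqs f d (drazin_index f))"
    unfolding drazin_index_def by (rule LeastI_ex)
  then obtain d where "drazin_eqs f d (drazin_index f)" by blast
  then have "weak_drazin_eqs f d (drazin_index f)"
    by (simp add: drazin_eqs_def weak_drazin_eqs_def)
  then have d: "weak_drazin_eqs f d s" using asm weak_drazin_eqs_mono by blast
  then have fs: "f ^ s = d * f ^ (s + 1)" and dd: "f * d\<^sup>2 = d"
    by (simp_all add: weak_drazin_eqs_def)
  have "w * f ^ (s + 1) = w * f * (d * f ^ (s + 1))"
    using fs by (simp add: mult.assoc)
  also have "\<dots> = (w * f * d) * f ^ (s + 1)" by (simp add: mult.assoc)
  also have "\<dots> = f ^ s" using weak_drazin_eqs_cancel[OF w dd] fs by simp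
  finally show "weak_drazin_eqs f w s" using w by (simp add: weak_drazin_eqs_def)
qed

section \<open>Additive perturbation\<close>

text \<open>
  On the image of \<open>p\<close> one has \<open>f = a * u\<close>, so \<open>f\<close> is inverted there by \<open>v * y\<close>.  Exchanging
  \<open>(a, y, u, v)\<close> and \<open>(f, v * y, v, u)\<close> recovers the passage from \<open>f\<close> back to \<open>a\<close>.
\<close>

lemma inverse_on_mult:
  assumes y: "inverse_on p a y"
    and uv: "u * v = 1" and vu: "v * u = 1"
    and u: "p * u * p = u * p" and v: "p * v * p = v * p"
    and f: "f * p = a * u * p"
  shows "inverse_on p f (v * y)"
proof -
  have y': "p * y = y" "p * a * p = a * p" "a * y * p = p" "y * a * p = p"
    using y by (simp_all add: inverse_on_def)
  have vy: "v * y = p * v * y"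
    using v y'(1) by (metis mult.assoc)
  have 1: "p * (v * y) = v * y" using vy by (simp add: mult.assoc)
  have up: "u * p = p * (u * p)" using u by (simp add: mult.assoc)
  have fp: "f * p = a * p * (u * p)" using f up by (metis mult.assoc)
  have 2: "p * f * p = f * p" using fp y'(2) by (metis mult.assoc)
  have "f * (v * y) = f * p * (v * y)" using 1 by (simp add: mult.assoc)
  also have "\<dots> = a * u * (p * (v * y))" using f by (simp add: mult.assoc)
  also have "\<dots> = a * (u * v) * y" using 1 by (simp add: mult.assoc)
  finally have "f * (v * y) = a * y" using uv by simp
  then have 3: "f * (v * y) * p = p" using y'(3) by simp
  have "v * y * f * p = v * (y * a * p) * (u * p)" using fp by (simp add: mult.assoc)
  also have "\<dots> = v * (p * u * p)" using y'(4) by (simp add: mult.assoc)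
  also have "\<dots> = v * u * p" using u by (simp add: mult.assoc)
  finally have 4: "v * y * f * p = p" using vu by simp
  from 1 2 3 4 show ?thesis by (simp add: inverse_on_def)
qed

text \<open>
  \<open>1 + x * b\<close> differs from \<open>1\<close> by something with image in \<open>p R\<close>, so it is the identity modulo
  \<open>p R\<close>; the same is then true of a right inverse, and both preserve \<open>p R\<close>.
\<close>

lemma one_plus_mult_preserves:
  fixes p x b v :: "'a::{ring,monoid_mult}"
  assumes p: "p * p = p" and px: "p * x = x"
    and uv: "(1 + x * b) * v = 1"
  shows "p * (1 + x * b) * p = (1 + x * b) * p" and "p * v * p = v * p"
proof -
  have "p * (1 + x * b) = p + x * b"
    using px by (simp add: distrib_left flip: mult.assoc)
  then show "p * (1 + x * b) * p = (1 + x * b) * p"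
    using p by (simp add: distrib_right)
  have "v = 1 - x * (b * v)" using uv by (simp add: distrib_right eq_diff_eq mult.assoc)
  then have vp: "v * p = p - x * (b * v) * p" by (metis left_diff_distrib mult_1_left)
  have "p * (x * (b * v) * p) = x * (b * v) * p" using px by (metis mult.assoc)
  then have "p * (v * p) = v * p" using vp p by (simp add: right_diff_distrib)
  then show "p * v * p = v * p" by (simp add: mult.assoc)
qed

lemma add_mult_eq_mult_one_plus:
  fixes p x a b :: "'a::{ring,monoid_mult}"
  assumes x: "inverse_on p a x" and b: "p * b * p = b * p"
  shows "(a + b) * p = a * (1 + x * b) * p"
proof -
  have "a * x * (b * p) = a * x * p * (b * p)" using b by (simp add: mult.assoc)
  also have "\<dots> = b * p" using x b by (simp add: inverse_on_def mult.assoc)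
  finally show ?thesis by (simp add: distrib_left distrib_right mult.assoc)
qed

text \<open>
  If \<open>v * y\<close> solves the equations for \<open>f\<close>, its image is the eventual image of \<open>f\<close>.  As \<open>y\<close> maps
  onto \<open>p R\<close> and \<open>v\<close> maps \<open>p R\<close> onto itself, this image is \<open>p R\<close> again.
\<close>

lemma weak_drazin_eqs_mult_imp_inverse_on:
  assumes y: "inverse_on p a y"
    and vu: "v * u = 1"
    and u: "p * u * p = u * p" and v: "p * v * p = v * p"
    and w: "weak_drazin_eqs f (v * y) s"
  shows "inverse_on p f (v * y)" and "p * f ^ s = f ^ s"
proof -
  let ?w = "v * y" and ?q = "f * (v * y)"
  have y': "p * y = y" "y * a * p = p" using y by (simp_all add: inverse_on_def)
  have ww: "f * ?w\<^sup>2 = ?w" using w by (simp add: weak_drazin_eqs_def)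
  have pw: "p * ?w = ?w" using v y'(1) by (metis mult.assoc)
  have pq: "p * ?q = ?q"
    using weak_drazin_eqs_mult_in_image[OF w] pw by (metis mult.assoc)
  \<comment> \<open>\<open>p\<close> lies in the right ideal generated by \<open>v * y\<close>, which is therefore all of \<open>p R\<close>.\<close>
  have "p = v * (p * u * p)" using vu u by (metis mult.assoc mult_1_left)
  also have "\<dots> = v * (y * a * p * u * p)" using y'(2) by simp
  finally have p_gen: "p = ?w * (a * p * u * p)" by (simp add: mult.assoc)
  have qw: "?q * ?w = ?w" using weak_drazin_eqs_absorb[OF w ww] .
  have qp: "?q * p = p" using p_gen qw by (metis mult.assoc)
  show "inverse_on p f ?w"
    using inverse_on_change_projection[OF weak_drazin_eqs_imp_inverse_on[OF w w] qp pq] .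
  show "p * f ^ s = f ^ s"
    using weak_drazin_eqs_imp_absorb_power[OF w] pq by (metis mult.assoc)
qed

lemma one_minus_mult_eq_0_iff:
  fixes p c :: "'a::{ring,monoid_mult}"
  shows "(1 - p) * c = 0 \<longleftrightarrow> p * c = c"
  by (auto simp: left_diff_distrib)

text \<open>
  The two clauses of condition (1) say that the ideal \<open>p R\<close> is invariant under \<open>b\<close> and that
  \<open>f ^ s\<close> has image in it.  The second clause only mentions \<open>f ^ s * (1 - p)\<close>; on \<open>p R\<close> the
  claim follows from invariance under \<open>a\<close> and \<open>b\<close>.
\<close>

lemma corner_conditions_iff:
  fixes a b p :: "'a::{ring,monoid_mult}"
  assumes p: "p * p = p" and a: "p * a * p = a * p"
  shows "(1 - p) * b * p = 0 \<and> (1 - p) * (a + b) ^ s * (1 - p) = 0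
    \<longleftrightarrow> p * b * p = b * p \<and> p * (a + b) ^ s = (a + b) ^ s"
proof -
  have b_iff: "(1 - p) * b * p = 0 \<longleftrightarrow> p * b * p = b * p"
    using one_minus_mult_eq_0_iff[of p "b * p"] by (simp add: mult.assoc)
  have "(1 - p) * (a + b) ^ s * (1 - p) = 0 \<longleftrightarrow> p * (a + b) ^ s = (a + b) ^ s"
    if b: "p * b * p = b * p"
  proof -
    have f: "p * ((a + b) * p) = (a + b) * p"
      using a b by (simp add: distrib_left distrib_right mult.assoc)
    have pow: "p * ((a + b) ^ j * p) = (a + b) ^ j * p" for j
    proof (induction j)
      case (Suc j)
      have "(a + b) ^ Suc j * p = (a + b) * p * ((a + b) ^ j * p)"
        using Suc by (simp add: mult.assoc)
      then show ?case using f by (metis mult.assoc)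
    qed (use p in simp)
    have "(1 - p) * (a + b) ^ s * (1 - p) = (1 - p) * (a + b) ^ s"
      using pow[of s] one_minus_mult_eq_0_iff[of p "(a + b) ^ s * p"]
      by (simp add: right_diff_distrib mult.assoc)
    then show ?thesis using one_minus_mult_eq_0_iff by simp
  qed
  then show ?thesis using b_iff by blast
qed

text \<open>
  The element \<open>x\<close> that defines \<open>p\<close> and \<open>u\<close> and the element \<open>y\<close> that is transported to \<open>f\<close> are
  independent of each other, because all of \<open>T_l a\<close> has the image \<open>p R\<close>.
\<close>

lemma perturbed_T_l_iff:
  fixes a b x y v :: "'a::{ring,monoid_mult}"
  assumes x: "x \<in> T_l a" and y: "y \<in> T_l a" and s: "0 < s"
    and uv: "(1 + x * b) * v = 1" and vu: "v * (1 + x * b) = 1"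
  shows "(1 - a * x) * b * a * x = 0 \<and> (1 - a * x) * (a + b) ^ s * (1 - a * x) = 0
    \<longleftrightarrow> v * y \<in> T_l (a + b) \<and> drazin_index (a + b) \<le> s"
proof -
  let ?p = "a * x" and ?u = "1 + x * b"
  obtain k l where xk: "weak_drazin_eqs a x k" and yl: "weak_drazin_eqs a y l"
    using x y T_l_iff by blast
  have p: "?p * ?p = ?p" using weak_drazin_eqs_imp_idempotent[OF xk] .
  have inv_x: "inverse_on ?p a x" and inv_y: "inverse_on ?p a y"
    using weak_drazin_eqs_imp_inverse_on[OF xk] xk yl by blast+
  have a: "?p * a * ?p = a * ?p" and px: "?p * x = x" using inv_x by (simp_all add: inverse_on_def)
  note u = one_plus_mult_preserves(1)[OF p px uv] and v = one_plus_mult_preserves(2)[OF p px uv]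
  have "?p * b * ?p = b * ?p \<and> ?p * (a + b) ^ s = (a + b) ^ s
    \<longleftrightarrow> weak_drazin_eqs (a + b) (v * y) s"
  proof
    assume asm: "?p * b * ?p = b * ?p \<and> ?p * (a + b) ^ s = (a + b) ^ s"
    then have "inverse_on ?p (a + b) (v * y)"
      using inverse_on_mult[OF inv_y uv vu u v] add_mult_eq_mult_one_plus[OF inv_x] by blast
    then show "weak_drazin_eqs (a + b) (v * y) s"
      using asm inverse_on_imp_weak_drazin_eqs by blast
  next
    assume w: "weak_drazin_eqs (a + b) (v * y) s"
    note inv_w = weak_drazin_eqs_mult_imp_inverse_on[OF inv_y vu u v w]
    have "?p * (a + b) * ?p = (a + b) * ?p" using inv_w(1) by (simp add: inverse_on_def)
    then have "?p * b * ?p = b * ?p"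
      using a by (metis add_left_cancel distrib_left distrib_right)
    then show "?p * b * ?p = b * ?p \<and> ?p * (a + b) ^ s = (a + b) ^ s" using inv_w(2) by blast
  qed
  then show ?thesis
    using corner_conditions_iff[OF p a, of b s] T_l_index_le_iff[OF s, of "v * y" "a + b"]
    by (simp add: mult.assoc)
qed

text \<open>
  For the inclusion from left to right, \<open>w \<in> T_l f\<close> inverts \<open>f\<close> on the eventual image \<open>p R\<close>
  of \<open>f\<close>, so \<open>u * w\<close> inverts \<open>a\<close> there, and \<open>w = v * (u * w)\<close>.
\<close>

lemma perturbed_T_l_eq:
  fixes a b x v :: "'a::{ring,monoid_mult}"
  assumes x: "x \<in> T_l a" and s: "0 < s"
    and uv: "(1 + x * b) * v = 1" and vu: "v * (1 + x * b) = 1"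
    and cond: "(1 - a * x) * b * a * x = 0 \<and> (1 - a * x) * (a + b) ^ s * (1 - a * x) = 0"
  shows "T_l (a + b) = {v * y | y. y \<in> T_l a}"
proof (intro equalityI subsetI)
  let ?p = "a * x" and ?u = "1 + x * b"
  fix w assume "w \<in> T_l (a + b)"
  then obtain m where w: "weak_drazin_eqs (a + b) w m" using T_l_iff by blast
  obtain k where k: "0 < k" and xk: "weak_drazin_eqs a x k" using x T_l_iff by blast
  have p: "?p * ?p = ?p" using weak_drazin_eqs_imp_idempotent[OF xk] .
  have inv_x: "inverse_on ?p a x" using weak_drazin_eqs_imp_inverse_on[OF xk xk] .
  have a: "?p * a * ?p = a * ?p" and px: "?p * x = x" using inv_x by (simp_all add: inverse_on_def)
  note u = one_plus_mult_preserves(1)[OF p px uv] and v = one_plus_mult_preserves(2)[OF p px uv]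
  have "?p * b * ?p = b * ?p"
    using cond corner_conditions_iff[OF p a, of b s] by (simp add: mult.assoc)
  then have fp: "(a + b) * ?p = a * ?u * ?p" using add_mult_eq_mult_one_plus[OF inv_x] by blast
  \<comment> \<open>The known element \<open>v * x\<close> of \<open>T_l f\<close> identifies the eventual image of \<open>f\<close> as \<open>p R\<close>.\<close>
  have z: "weak_drazin_eqs (a + b) (v * x) s"
    using perturbed_T_l_iff[OF x x s uv vu] cond T_l_index_le_iff[OF s] by blast
  have pvx: "?p * (v * x) = v * x" using v px by (metis mult.assoc)
  have "(a + b) * (v * x) = (a + b) * ?p * (v * x)" using pvx by (simp add: mult.assoc)
  also have "\<dots> = a * ?u * (?p * (v * x))" using fp by (metis mult.assoc)
  also have "\<dots> = a * (?u * v) * x" using pvx by (simp add: mult.assoc)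
  finally have "(a + b) * (v * x) = ?p" using uv by simp
  then have inv_w: "inverse_on ?p (a + b) w"
    using weak_drazin_eqs_imp_inverse_on[OF z w] by simp
  have "(a + b) * v * ?p = (a + b) * ?p * (v * ?p)" using v by (metis mult.assoc)
  also have "\<dots> = a * ?u * (?p * v * ?p)" using fp by (metis mult.assoc)
  also have "\<dots> = a * (?u * v) * ?p" using v by (metis mult.assoc)
  finally have "a * ?p = (a + b) * v * ?p" using uv by simp
  then have "inverse_on ?p a (?u * w)" using inverse_on_mult[OF inv_w vu uv v u] by blast
  then have "weak_drazin_eqs a (?u * w) k"
    using inverse_on_imp_weak_drazin_eqs weak_drazin_eqs_imp_absorb_power[OF xk] by blast
  then have "?u * w \<in> T_l a" using k T_l_iff by blast
  moreover have "w = v * (?u * w)" using vu by (metis mult.assoc mult_1_left)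
  ultimately show "w \<in> {v * y | y. y \<in> T_l a}" by blast
next
  fix w assume "w \<in> {v * y | y. y \<in> T_l a}"
  then show "w \<in> T_l (a + b)" using perturbed_T_l_iff[OF x _ s uv vu] cond by blast
qed

theorem theorem3p1:
  fixes star :: "'a::{ring,monoid_mult} \<Rightarrow> 'a"
    and a b f ap apm :: 'a
    and s :: nat
  assumes "involution star"
    and "drazin_invertible a"
    and "ap \<in> T_l a" and "apm \<in> T_l a"
    and "f = a + b"
    and "0 < s"
    and "is_invertible (1 + ap * b)"
  shows "((1 - a * ap) * b * a * ap = 0 \<and> (1 - a * ap) * (a + b) ^ s * (1 - a * ap) = 0
            \<longleftrightarrow> ring_inv (1 + ap * b) * ap \<in> T_l f \<and> drazin_index f \<le> s)
       \<and> (ring_inv (1 + ap * b) * ap \<in> T_l f \<and> drazin_index f \<le> s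
            \<longleftrightarrow> ring_inv (1 + ap * b) * apm \<in> T_l f \<and> drazin_index f \<le> s)
       \<and> ((1 - a * ap) * b * a * ap = 0 \<and> (1 - a * ap) * (a + b) ^ s * (1 - a * ap) = 0
            \<longrightarrow> T_l f = {ring_inv (1 + ap * b) * y | y. y \<in> T_l a})"
proof -
  obtain v where v: "(1 + ap * b) * v = 1" "v * (1 + ap * b) = 1"
    using \<open>is_invertible (1 + ap * b)\<close> is_invertible_def by blast
  then have "ring_inv (1 + ap * b) = v" by (rule ring_inv_unique)
  then show ?thesis
    using perturbed_T_l_iff[OF \<open>ap \<in> T_l a\<close> \<open>ap \<in> T_l a\<close> \<open>0 < s\<close> v]
      perturbed_T_l_iff[OF \<open>ap \<in> T_l a\<close> \<open>apm \<in> T_l a\<close> \<open>0 < s\<close> v]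
      perturbed_T_l_eq[OF \<open>ap \<in> T_l a\<close> \<open>0 < s\<close> v]
    by (simp only: \<open>f = a + b\<close>) blast
qed

end
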